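(* (i) Let $m\ge1$, let $a_1,\ldots,a_m$ be integers and $n>0$ an integer. Then, for either choice of sign, $$\sum_{k=0}^{n-1}(\pm1)^k(2k+1)\prod_{i=1}^m\binom{a_in-1}k\equiv0\pmod n,\qquad \sum_{k=0}^{n-1}(\pm1)^k(4k^3-1)\prod_{i=1}^m\binom{a_in-1}k\equiv0\pmod n.$$ Also $$\gcd(a_1+\cdots+a_m-1,2)\sum_{k=0}^{n-1}(-1)^{km}(2k+1)\prod_{i=1}^m\binom{a_in-1}k\equiv0\pmod {n^2},$$ $$6\sum_{k=0}^{n-1}(-1)^{km}(3k^2+3k+1)\prod_{i=1}^m\binom{a_in-1}k\equiv0\pmod {n^2},$$ $$\sum_{k=0}^{n-1}(-1)^k(4k^3-1)\prod_{i=1}^m\binom{a_in-1}k\binom{-a_in-1}k\equiv0\pmod{n^2},$$ and $$\gcd(a_1+\cdots+a_m-1,2)\sum_{k=0}^{n-1}(3k^2+3k+1)\prod_{i=1}^m\binom{a_in-1}k\binom{-a_in-1}k\equiv0\pmod{n^3}.$$ (ii) For any positive integers $a,b,n$: $$\frac1n\sum_{k=0}^{n-1}\frac{\binom{n-1}k^a\binom{-n-1}k^a}{4k^2-1}\in\mathbb Z,\qquad \frac1n\sum_{k=0}^{n-1}\frac{\binom{n-1}k^a\binom{-n-1}k^a}{\binom{k+2}2}\in\mathbb Z,$$ $$\frac1n\sum_{k=0}^{n-1}(-1)^k\left(1+\frac{2k}{4k^2-1}\right)\binom{n-1}k^a\binom{-n-1}k^a\in\mathbb Z,\qquad \frac1n\sum_{k=0}^{n-1}(-1)^k\left(4-\frac{2k+3}{\binom{k+2}2}\right)\binom{n-1}k^a\binom{-n-1}k^a\in\mathbb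 Z,$$ and $$\sum_{k=0}^{n-1}\frac{(-1)^{(a+b)k}}{4k^2-1}\binom{n-1}k^a\binom{-n-1}k^b\in\mathbb Z,\qquad \sum_{k=0}^{n-1}\frac{(-1)^{(a+b-1)k}k}{4k^2-1}\binom{n-1}k^a\binom{-n-1}k^b\in\mathbb Z,$$ $$\sum_{k=0}^{n-1}\frac{(-1)^{(a+b)k}}{\binom{k+2}2}\binom{n-1}k^a\binom{-n-1}k^b\in\mathbb Z,\qquad \sum_{k=0}^{n-1}\frac{(-1)^{(a+b-1)k}(2k+3)}{\binom{k+2}2}\binom{n-1}k^a\binom{-n-1}k^b\in\mathbb Z,$$ $$\sum_{k=0}^{n-1}\frac{(-1)^{(a+b)k}(3k+1)}{(2k+1)\binom{2k}k}\binom{n-1}k^a\binom{-n-1}k^b\in\mathbb Z,\qquad \sum_{k=0}^{n-1}\frac{(-1)^{(a+b-1)k}(5k+3)}{(2k+1)\binom{2k}k}\binom{n-1}k^a\binom{-n-1}k^b\in\mathbb Z.$$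
   Context: For an integer $x$ and $k\in\mathbb N$, $\binom xk=x(x-1)\cdots(x-k+1)/k!$ (so negative upper arguments are allowed, e.g. $\binom{-n-1}k=(-1)^k\binom{n+k}k$). *)

theory Defs
  imports Complex_Main "HOL-Number_Theory.Number_Theory"
begin

text \<open>
  The library's \<open>gchoose\<close> is defined at type \<^typ>\<open>int\<close>, but its input syntax is constrained
  to fields of characteristic 0, so an integer term \<open>x gchoose k\<close> cannot be entered. This is
  that instance, written out; the division is exact, as \<open>of_int_int_gchoose\<close> records.
\<close>

definition int_gchoose :: "int \<Rightarrow> nat \<Rightarrow> int" where
  "int_gchoose x k = (\<Prod>i<k. x - int i) div fact k"

lemma of_int_int_gchoose: "(of_int (int_gchoose x k) :: rat) = of_int x gchoose k"
  using of_int_gbinomial[of x k, where 'a = rat]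
  by (simp add: int_gchoose_def gbinomial_prod_rev[of x k] atLeast0LessThan)

end

theory Submission
  imports Defs
begin

text \<open>
  Put \<open>c\<^sub>x(k) = (-1)\<^sup>k binom(x - 1, k)\<close>, so that \<open>K (c\<^sub>x(K) - c\<^sub>x(K - 1)) = - x c\<^sub>x(K - 1)\<close>.

  For (i), let \<open>Q(k)\<close> be the product of the \<open>c\<^sub>x(k)\<close> over \<open>x = a\<^sub>i n\<close>, and \<open>S\<close> the sum of the \<open>a\<^sub>i\<close>. Then
  \<open>K (Q(K) - Q(K - 1))\<close> is divisible by \<open>n\<close>, and \<open>K\<^sup>2 (Q(K) - Q(K - 1))\<close> is \<open>- n S K Q(K - 1)\<close>
  modulo \<open>n\<^sup>2\<close>; when the factors come in pairs \<open>x, -x\<close> the first-order term vanishes and the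
  expansion can be pushed to \<open>n\<^sup>3\<close>. Each weight has an indefinite sum \<open>F(l)\<close> divisible by \<open>l\<close>,
  \<open>l\<^sup>2\<close> or \<open>l\<^sup>3\<close>, so summation by parts gives the congruences modulo \<open>n\<close>, and reduces those
  modulo \<open>n\<^sup>2\<close> and \<open>n\<^sup>3\<close> to congruences modulo \<open>n\<close> for sums with smaller weights.

  For (ii), let \<open>Q(k) = c\<^sub>n(k)\<^sup>a c\<^sub>-\<^sub>n(k)\<^sup>b\<close>, which vanishes at \<open>k = n\<close>. The differences \<open>Q(k + 1) - Q(k)\<close> are
  divisible by \<open>binom(2k + 1, k)\<close>, a multiple of \<open>2k + 1\<close> and half of a multiple of \<open>k + 2\<close>; this
  absorbs the denominators of the indefinite sums of the weights. When \<open>a = b\<close>, moreover,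
  \<open>(k + 1) (Q(k + 1) - Q(k))\<close> is divisible by \<open>n binom(2k + 1, k)\<close>.
\<close>

section \<open>Summation by parts\<close>

lemma sum_by_parts:
  fixes F Q :: "nat \<Rightarrow> 'a :: comm_ring_1"
  assumes "F 0 = 0" and "\<And>k. F (Suc k) - F k = f k"
  shows "(\<Sum>k<n. f k * Q k) = F n * Q n - (\<Sum>k<n. F (Suc k) * (Q (Suc k) - Q k))"
proof (induction n)
  case 0
  then show ?case using assms(1) by simp
next
  case (Suc n)
  then show ?case by (simp add: assms(2)[symmetric] algebra_simps)
qed

section \<open>Signed binomial coefficients\<close>

lemma int_gchoose_Suc: "int (Suc k) * int_gchoose x (Suc k) = (x - int k) * int_gchoose x k"
proof -
  have "(of_int (int (Suc k) * int_gchoose x (Suc k)) :: rat) = of_int ((x - int k) * int_gchoose x k)"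
    using gbinomial_mult_1[of "of_int x :: rat" k]
    by (simp add: of_int_int_gchoose algebra_simps)
  then show ?thesis unfolding of_int_eq_iff .
qed

text \<open>The sign makes the step ratio from \<open>k\<close> to \<open>k + 1\<close> equal to
  \<open>1 - x / (k + 1)\<close>, so consecutive values differ by a multiple of \<open>x\<close> up
  to the denominator \<open>k + 1\<close>.\<close>

definition sbinom :: "int \<Rightarrow> nat \<Rightarrow> int" where
  "sbinom x k = (-1) ^ k * int_gchoose (x - 1) k"

lemma sbinom_Suc: "int (Suc k) * sbinom x (Suc k) = (int (Suc k) - x) * sbinom x k"
proof -
  have "int (Suc k) * sbinom x (Suc k) = - ((-1) ^ k * (int (Suc k) * int_gchoose (x - 1) (Suc k)))"
    by (simp add: sbinom_def)
  also have "\<dots> = (int (Suc k) - x) * sbinom x k"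
    unfolding int_gchoose_Suc by (simp add: sbinom_def algebra_simps)
  finally show ?thesis .
qed

lemma sbinom_diff: "int (Suc k) * (sbinom x (Suc k) - sbinom x k) = - x * sbinom x k"
  using sbinom_Suc[of k x] by (simp add: algebra_simps)

text \<open>The step ratios \<open>1 - x / (k + 1)\<close> and \<open>1 + x / (k + 1)\<close>
  multiply to \<open>1 - x^2 / (k + 1)^2\<close>, which has no term linear in
  \<open>x\<close>.\<close>

lemma sbinom_mult_uminus_diff:
  "int (Suc k) ^ 2 * (sbinom x (Suc k) * sbinom (- x) (Suc k) - sbinom x k * sbinom (- x) k)
    = - (x ^ 2) * (sbinom x k * sbinom (- x) k)"
proof -
  have "int (Suc k) ^ 2 * (sbinom x (Suc k) * sbinom (- x) (Suc k))
      = (int (Suc k) * sbinom x (Suc k)) * (int (Suc k) * sbinom (- x) (Suc k))"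
    by (simp add: power2_eq_square)
  also have "\<dots> = (int (Suc k) ^ 2 - x ^ 2) * (sbinom x k * sbinom (- x) k)"
    unfolding sbinom_Suc by (simp add: power2_eq_square algebra_simps)
  finally show ?thesis by (simp only: right_diff_distrib left_diff_distrib)
qed

section \<open>Differences of products\<close>

lemma dvd_mult_prod_diff:
  fixes c c' :: "'i \<Rightarrow> int"
  assumes "finite I" and "\<And>i. i \<in> I \<Longrightarrow> M dvd L * (c' i - c i)"
  shows "M dvd L * (prod c' I - prod c I)"
  using assms
proof (induction I)
  case (insert i I)
  have "L * (prod c' (insert i I) - prod c (insert i I))
      = prod c' I * (L * (c' i - c i)) + c i * (L * (prod c' I - prod c I))"
    using insert.hyps by (simp add: algebra_simps)
  then show ?case using insert by simp
qed simp

text \<open>Formally \<open>c' i = c i * (1 - a i * N / K)\<close>, and \<open>sum a I\<close>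
  collects the linear terms. Full expansion would leave higher powers of \<open>K\<close> in
  denominators; the induction meets only products of two differences, each a multiple of
  \<open>N\<close> after scaling by \<open>K\<close>.\<close>

lemma prod_diff_first_order:
  fixes c c' a :: "'i \<Rightarrow> int"
  assumes "finite I" and "\<And>i. i \<in> I \<Longrightarrow> K * (c' i - c i) = - (a i * N) * c i"
  shows "N ^ 2 dvd K ^ 2 * (prod c' I - prod c I) + N * K * sum a I * prod c I"
  using assms
proof (induction I)
  case (insert i I)
  have "N dvd K * (prod c' I - prod c I)"
    by (rule dvd_mult_prod_diff) (use insert in auto)
  then obtain t where t: "K * (prod c' I - prod c I) = N * t" ..
  have d: "K * (c' i - c i) = - (a i * N) * c i" using insert.prems by simp
  \<comment> \<open>The middle summand vanishes by \<open>d\<close>; the last one is a product of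
    two multiples of \<open>N\<close>.\<close>
  have "K ^ 2 * (prod c' (insert i I) - prod c (insert i I))
          + N * K * sum a (insert i I) * prod c (insert i I)
      = c i * (K ^ 2 * (prod c' I - prod c I) + N * K * sum a I * prod c I)
        + K * prod c I * (K * (c' i - c i) + a i * N * c i)
        + (K * (c' i - c i)) * (K * (prod c' I - prod c I))"
    using insert.hyps by (simp add: algebra_simps power2_eq_square)
  also have "\<dots> = c i * (K ^ 2 * (prod c' I - prod c I) + N * K * sum a I * prod c I)
        + N ^ 2 * (- a i * c i * t)"
    unfolding d t by (simp add: power2_eq_square)
  finally show ?case using insert by simp
qed simp

text \<open>Now the ratios are \<open>1 - (a i * N / K)^2\<close>. The cross term pairs a multiple
  of \<open>N ^ 2\<close> with a multiple of \<open>N\<close>; the latter comes from the last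
  hypothesis, applied to the rest of the product.\<close>

lemma prod_diff_second_order:
  fixes c c' a :: "'i \<Rightarrow> int"
  assumes "finite I" and "\<And>i. i \<in> I \<Longrightarrow> K ^ 2 * (c' i - c i) = - ((a i * N) ^ 2) * c i"
    and "\<And>i. i \<in> I \<Longrightarrow> N dvd K * (c' i - c i)"
  shows "N ^ 3 dvd K ^ 3 * (prod c' I - prod c I) + N ^ 2 * K * (\<Sum>i\<in>I. a i ^ 2) * prod c I"
  using assms
proof (induction I)
  case (insert i I)
  have "N dvd K * (prod c' I - prod c I)"
    by (rule dvd_mult_prod_diff) (use insert in auto)
  then obtain t where t: "K * (prod c' I - prod c I) = N * t" ..
  have d: "K ^ 2 * (c' i - c i) = - ((a i * N) ^ 2) * c i" using insert.prems by simp
  have "K ^ 3 * (prod c' (insert i I) - prod c (insert i I))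
          + N ^ 2 * K * (\<Sum>i\<in>insert i I. a i ^ 2) * prod c (insert i I)
      = c i * (K ^ 3 * (prod c' I - prod c I) + N ^ 2 * K * (\<Sum>i\<in>I. a i ^ 2) * prod c I)
        + K * prod c I * (K ^ 2 * (c' i - c i) + (a i * N) ^ 2 * c i)
        + (K ^ 2 * (c' i - c i)) * (K * (prod c' I - prod c I))"
    using insert.hyps by (simp add: algebra_simps power2_eq_square power3_eq_cube)
  also have "\<dots> = c i * (K ^ 3 * (prod c' I - prod c I) + N ^ 2 * K * (\<Sum>i\<in>I. a i ^ 2) * prod c I)
        + N ^ 3 * (- (a i ^ 2) * c i * t)"
    unfolding d t by (simp add: power2_eq_square power3_eq_cube)
  finally show ?case using insert by simp
qed simp

text \<open>\<open>L k\<close> stands for the power of \<open>k\<close> that divides the indefinite sum \<open>F k\<close>.\<close>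

lemma dvd_sum_by_parts:
  fixes Q F f :: "nat \<Rightarrow> int"
  assumes "\<And>k. M dvd L (Suc k) * (Q (Suc k) - Q k)" and "M dvd L n"
    and "F 0 = 0" and "\<And>k. F (Suc k) - F k = f k" and "\<And>k. L k dvd F k"
  shows "M dvd (\<Sum>k<n. f k * Q k)"
proof -
  have "M dvd F (Suc k) * (Q (Suc k) - Q k)" for k
    using assms(1)[of k] assms(5)[of "Suc k"] by (meson dvd_refl dvd_trans mult_dvd_mono)
  then have "M dvd (\<Sum>k<n. F (Suc k) * (Q (Suc k) - Q k))"
    by (rule dvd_sum)
  moreover have "M dvd F n * Q n"
    using dvd_trans[OF assms(2) assms(5)] by (rule dvd_mult2)
  ultimately show ?thesis
    unfolding sum_by_parts[of F f, OF assms(3,4)] by (rule dvd_diff[rotated])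
qed

section \<open>Congruences for products of signed binomial coefficients\<close>

context
  fixes Q :: "nat \<Rightarrow> int" and n :: nat
  assumes first_diff: "\<And>k. int n dvd int (Suc k) * (Q (Suc k) - Q k)"
begin

lemma dvd_sum_signed_odd:
  assumes "s \<in> {1, -1}"
  shows "int n dvd (\<Sum>k<n. s ^ k * (2 * int k + 1) * Q k)"
proof (rule dvd_sum_by_parts[where L = int, OF first_diff])
  \<comment> \<open>With sign -1 consecutive terms add up instead of cancelling, and
    \<open>(k + 1) + k\<close> is the weight.\<close>
  define F where "F = (\<lambda>l. if s = 1 then int l ^ 2 else - (s ^ l * int l))"
  show "F 0 = 0" "int k dvd F k" for k
    by (simp_all add: F_def)
  show "F (Suc k) - F k = s ^ k * (2 * int k + 1)" for k
    using assms by (auto simp: F_def power2_eq_square algebra_simps)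
qed simp

lemma dvd_sum_signed_cubic:
  assumes "s \<in> {1, -1}"
  shows "int n dvd (\<Sum>k<n. s ^ k * (4 * int k ^ 3 - 1) * Q k)"
proof (rule dvd_sum_by_parts[where L = int, OF first_diff])
  \<comment> \<open>The branches rest on \<open>(k + 1)^2 k^2 - k^2 (k - 1)^2 = 4 k^3\<close> and
    \<open>(k + 1)^2 (2 k - 1) + k^2 (2 k - 3) = 4 k^3 - 1\<close>.\<close>
  define F where "F = (\<lambda>l. if s = 1 then int l ^ 2 * (int l - 1) ^ 2 - int l
                                     else - (s ^ l * int l ^ 2 * (2 * int l - 3)))"
  show "F 0 = 0" "int k dvd F k" for k
    by (simp_all add: F_def power2_eq_square)
  show "F (Suc k) - F k = s ^ k * (4 * int k ^ 3 - 1)" for k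
    using assms by (auto simp: F_def power2_eq_square power3_eq_cube algebra_simps)
qed simp

lemma dvd_sum_unweighted: "int n dvd (\<Sum>k<n. Q k)"
proof -
  have "int n dvd (\<Sum>k<n. 1 * Q k)"
    by (rule dvd_sum_by_parts[where L = int and F = int, OF first_diff]) auto
  then show ?thesis by simp
qed

lemma dvd_sum_odd: "int n dvd (\<Sum>k<n. (2 * int k + 1) * Q k)"
  using dvd_sum_signed_odd[of 1] by simp

lemma dvd_twice_sum_linear: "int n dvd 2 * (\<Sum>k<n. int (Suc k) * Q k)"
proof -
  have "2 * (\<Sum>k<n. int (Suc k) * Q k) = (\<Sum>k<n. (2 * int k + 1) * Q k) + (\<Sum>k<n. Q k)"
    by (simp add: sum_distrib_left sum.distrib[symmetric] algebra_simps)
  then show ?thesis using dvd_sum_odd dvd_sum_unweighted by simp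
qed

text \<open>The weight \<open>k + 1\<close> needs a factor 2: the gcd supplies it when
  \<open>S\<close> is odd, and \<open>S'\<close> itself when \<open>S\<close> is even. Separating
  \<open>S'\<close> from \<open>S\<close> allows a sum of squares as coefficient.\<close>

lemma dvd_gcd_mult_sum_linear:
  assumes "even (S - S')"
  shows "int n dvd gcd (S - 1) 2 * (S' * (\<Sum>k<n. int (Suc k) * Q k))"
proof -
  have "2 dvd gcd (S - 1) 2 * S'"
  proof (cases "even S")
    case False
    then have "gcd (S - 1) 2 = 2" by simp
    then show ?thesis by simp
  qed (use assms in auto)
  then obtain t where "gcd (S - 1) 2 * S' = 2 * t" ..
  then have "gcd (S - 1) 2 * (S' * X) = t * (2 * X)" for X
    by (simp only: mult.assoc[symmetric] mult.commute[of t])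
  then show ?thesis using dvd_twice_sum_linear by (simp only: dvd_mult)
qed

text \<open>\<open>6 (k + 1)^2 = 2 (3 k^2 + 3 k + 1) + 3 (2 k + 1) + 1\<close>, and these weights
  have indefinite sums \<open>l^3\<close>, \<open>l^2\<close> and \<open>l\<close>.\<close>

lemma dvd_six_sum_square: "int n dvd 6 * (\<Sum>k<n. int (Suc k) ^ 2 * Q k)"
proof -
  have "int n dvd (\<Sum>k<n. (3 * int k ^ 2 + 3 * int k + 1) * Q k)"
    by (rule dvd_sum_by_parts[where L = int and F = "\<lambda>l. int l ^ 3", OF first_diff])
      (auto simp: power2_eq_square power3_eq_cube algebra_simps)
  moreover have "6 * (\<Sum>k<n. int (Suc k) ^ 2 * Q k)
      = 2 * (\<Sum>k<n. (3 * int k ^ 2 + 3 * int k + 1) * Q k) + 3 * (\<Sum>k<n. (2 * int k + 1) * Q k)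
        + (\<Sum>k<n. Q k)"
    by (simp add: sum_distrib_left sum.distrib[symmetric] algebra_simps power2_eq_square)
  ultimately show ?thesis using dvd_sum_odd dvd_sum_unweighted by simp
qed

end

section \<open>Products with upper arguments at multiples of n\<close>

context
  fixes m n :: nat and a :: "nat \<Rightarrow> int"
begin

definition signed_prod :: "nat \<Rightarrow> int" where
  "signed_prod k = (\<Prod>i=1..m. sbinom (a i * int n) k)"

definition signed_pair_prod :: "nat \<Rightarrow> int" where
  "signed_pair_prod k = (\<Prod>i=1..m. sbinom (a i * int n) k * sbinom (- (a i * int n)) k)"

lemma signed_prod_eq: "signed_prod k = (-1) ^ (k * m) * (\<Prod>i=1..m. int_gchoose (a i * int n - 1) k)"
  by (simp add: signed_prod_def sbinom_def prod.distrib power_mult)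

lemma signed_pair_prod_eq:
  "signed_pair_prod k = (\<Prod>i=1..m. int_gchoose (a i * int n - 1) k * int_gchoose (- a i * int n - 1) k)"
  unfolding signed_pair_prod_def
  by (rule prod.cong) (simp_all add: sbinom_def power_mult_distrib[symmetric])

lemma signed_prod_diff: "int n dvd int (Suc k) * (signed_prod (Suc k) - signed_prod k)"
  unfolding signed_prod_def by (rule dvd_mult_prod_diff) (simp_all add: sbinom_diff del: of_nat_Suc)

lemma signed_prod_diff_first_order:
  "int n ^ 2 dvd int (Suc k) ^ 2 * (signed_prod (Suc k) - signed_prod k)
     + int n * int (Suc k) * (\<Sum>i=1..m. a i) * signed_prod k"
  unfolding signed_prod_def
  by (rule prod_diff_first_order) (simp_all add: sbinom_diff del: of_nat_Suc)

lemma sbinom_pair_diff: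
  "int n dvd int (Suc k) * (sbinom (x * int n) (Suc k) * sbinom (- (x * int n)) (Suc k)
     - sbinom (x * int n) k * sbinom (- (x * int n)) k)"
proof -
  have "int (Suc k) * (c' * d' - c * d) = c' * (int (Suc k) * (d' - d)) + d * (int (Suc k) * (c' - c))"
    for c' d' c d :: int by (simp add: algebra_simps)
  then show ?thesis by (simp add: sbinom_diff del: of_nat_Suc)
qed

lemma signed_pair_prod_diff: "int n dvd int (Suc k) * (signed_pair_prod (Suc k) - signed_pair_prod k)"
  unfolding signed_pair_prod_def by (rule dvd_mult_prod_diff) (simp_all only: sbinom_pair_diff finite_atLeastAtMost)

lemma signed_pair_prod_diff_square:
  "int n ^ 2 dvd int (Suc k) ^ 2 * (signed_pair_prod (Suc k) - signed_pair_prod k)"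
  unfolding signed_pair_prod_def
  by (rule dvd_mult_prod_diff) (simp_all add: sbinom_mult_uminus_diff power_mult_distrib del: of_nat_Suc)

lemma signed_pair_prod_diff_second_order:
  "int n ^ 3 dvd int (Suc k) ^ 3 * (signed_pair_prod (Suc k) - signed_pair_prod k)
     + int n ^ 2 * int (Suc k) * (\<Sum>i=1..m. a i ^ 2) * signed_pair_prod k"
  unfolding signed_pair_prod_def
proof (rule prod_diff_second_order)
  fix i
  show "int (Suc k) ^ 2 * (sbinom (a i * int n) (Suc k) * sbinom (- (a i * int n)) (Suc k)
      - sbinom (a i * int n) k * sbinom (- (a i * int n)) k)
      = - ((a i * int n) ^ 2) * (sbinom (a i * int n) k * sbinom (- (a i * int n)) k)"
    by (rule sbinom_mult_uminus_diff)
qed (simp_all only: sbinom_pair_diff finite_atLeastAtMost)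

text \<open>With indefinite sum \<open>l^2\<close>, the first-order expansion (error
  \<open>E\<close>, a multiple of \<open>n^2\<close>) leaves \<open>n\<close> times a sum of weight
  \<open>k + 1\<close>, which the gcd makes divisible by \<open>n\<close>.\<close>

lemma gcd_sum_odd_signed_prod:
  "int n ^ 2 dvd gcd ((\<Sum>i=1..m. a i) - 1) 2 * (\<Sum>k<n. (2 * int k + 1) * signed_prod k)"
proof -
  define S g X where "S = (\<Sum>i=1..m. a i)" and "g = gcd (S - 1) 2"
    and "X = (\<Sum>k<n. int (Suc k) * signed_prod k)"
  define E where "E k = int (Suc k) ^ 2 * (signed_prod (Suc k) - signed_prod k)
     + int n * int (Suc k) * S * signed_prod k" for k
  have "(\<Sum>k<n. (2 * int k + 1) * signed_prod k)
      = int n ^ 2 * signed_prod n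
        - (\<Sum>k<n. int (Suc k) ^ 2 * (signed_prod (Suc k) - signed_prod k))"
    by (rule sum_by_parts) (simp_all add: power2_eq_square algebra_simps)
  also have "(\<Sum>k<n. int (Suc k) ^ 2 * (signed_prod (Suc k) - signed_prod k)) = (\<Sum>k<n. E k) - int n * (S * X)"
    by (simp add: E_def X_def sum_distrib_left sum.distrib mult_ac del: of_nat_Suc)
  finally have sum_eq: "(\<Sum>k<n. (2 * int k + 1) * signed_prod k)
      = int n ^ 2 * signed_prod n - ((\<Sum>k<n. E k) - int n * (S * X))" .
  have "g * (\<Sum>k<n. (2 * int k + 1) * signed_prod k)
      = g * (int n ^ 2 * signed_prod n) - g * (\<Sum>k<n. E k) + int n * (g * (S * X))"
    unfolding sum_eq by (simp only: algebra_simps)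
  moreover have "int n ^ 2 dvd (\<Sum>k<n. E k)"
    unfolding E_def S_def by (intro dvd_sum signed_prod_diff_first_order)
  moreover have "int n dvd g * (S * X)"
    unfolding g_def X_def by (rule dvd_gcd_mult_sum_linear[OF signed_prod_diff]) simp
  then have "int n ^ 2 dvd int n * (g * (S * X))"
    unfolding power2_eq_square by (rule mult_dvd_mono[OF dvd_refl])
  ultimately show ?thesis unfolding g_def S_def by simp
qed

text \<open>The indefinite sum \<open>l^3\<close> has one factor more than the first-order expansion
  uses, so the residual weight is \<open>(k + 1)^2\<close>; this is where the 6 is spent.\<close>

lemma six_sum_cubic_signed_prod:
  "int n ^ 2 dvd 6 * (\<Sum>k<n. (3 * int k ^ 2 + 3 * int k + 1) * signed_prod k)"
proof -
  define S X where "S = (\<Sum>i=1..m. a i)" and "X = (\<Sum>k<n. int (Suc k) ^ 2 * signed_prod k)"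
  define E where "E k = int (Suc k) ^ 2 * (signed_prod (Suc k) - signed_prod k)
     + int n * int (Suc k) * S * signed_prod k" for k
  have "(\<Sum>k<n. (3 * int k ^ 2 + 3 * int k + 1) * signed_prod k)
      = int n ^ 3 * signed_prod n
        - (\<Sum>k<n. int (Suc k) ^ 3 * (signed_prod (Suc k) - signed_prod k))"
    by (rule sum_by_parts) (simp_all add: power2_eq_square power3_eq_cube algebra_simps)
  also have "(\<Sum>k<n. int (Suc k) ^ 3 * (signed_prod (Suc k) - signed_prod k))
      = (\<Sum>k<n. int (Suc k) * E k) - int n * (S * X)"
    by (simp add: E_def X_def sum_distrib_left sum.distrib distrib_left power2_eq_square
        power3_eq_cube mult_ac del: of_nat_Suc)
  finally have sum_eq: "(\<Sum>k<n. (3 * int k ^ 2 + 3 * int k + 1) * signed_prod k)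
      = int n ^ 3 * signed_prod n - ((\<Sum>k<n. int (Suc k) * E k) - int n * (S * X))" .
  have "6 * (\<Sum>k<n. (3 * int k ^ 2 + 3 * int k + 1) * signed_prod k)
      = 6 * (int n ^ 3 * signed_prod n) - 6 * (\<Sum>k<n. int (Suc k) * E k) + int n * (S * (6 * X))"
    unfolding sum_eq by (simp only: algebra_simps)
  moreover have "int n ^ 2 dvd (\<Sum>k<n. int (Suc k) * E k)"
    unfolding E_def S_def by (intro dvd_sum dvd_mult signed_prod_diff_first_order)
  moreover have "int n dvd 6 * X"
    unfolding X_def by (rule dvd_six_sum_square[OF signed_prod_diff])
  then have "int n ^ 2 dvd int n * (S * (6 * X))"
    unfolding power2_eq_square by (rule mult_dvd_mono[OF dvd_refl dvd_mult])
  moreover have "int n ^ 2 dvd 6 * (int n ^ 3 * signed_prod n)"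
    by (intro dvd_mult dvd_mult2 le_imp_power_dvd) simp
  ultimately show ?thesis by simp
qed

text \<open>The alternating indefinite sum of \<open>4 k^3 - 1\<close> is divisible by
  \<open>l^2\<close>, and for pairs \<open>l^2\<close> times a difference is already a multiple of
  \<open>n^2\<close>: no residual sum arises.\<close>

lemma alternating_sum_cubic_signed_pair_prod:
  "int n ^ 2 dvd (\<Sum>k<n. (-1) ^ k * (4 * int k ^ 3 - 1) * signed_pair_prod k)"
  by (rule dvd_sum_by_parts[where L = "\<lambda>k. int k ^ 2" and F = "\<lambda>l. (-1) ^ Suc l * int l ^ 2 * (2 * int l - 3)"])
    (use signed_pair_prod_diff_square in \<open>auto simp: power2_eq_square power3_eq_cube algebra_simps\<close>)

lemma gcd_sum_cubic_signed_pair_prod: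
  "int n ^ 3 dvd gcd ((\<Sum>i=1..m. a i) - 1) 2 * (\<Sum>k<n. (3 * int k ^ 2 + 3 * int k + 1) * signed_pair_prod k)"
proof -
  define S T g X where "S = (\<Sum>i=1..m. a i)" and "T = (\<Sum>i=1..m. a i ^ 2)" and "g = gcd (S - 1) 2"
    and "X = (\<Sum>k<n. int (Suc k) * signed_pair_prod k)"
  define E where "E k = int (Suc k) ^ 3 * (signed_pair_prod (Suc k) - signed_pair_prod k)
     + int n ^ 2 * int (Suc k) * T * signed_pair_prod k" for k
  have "(\<Sum>k<n. (3 * int k ^ 2 + 3 * int k + 1) * signed_pair_prod k)
      = int n ^ 3 * signed_pair_prod n
        - (\<Sum>k<n. int (Suc k) ^ 3 * (signed_pair_prod (Suc k) - signed_pair_prod k))"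
    by (rule sum_by_parts) (simp_all add: power2_eq_square power3_eq_cube algebra_simps)
  also have "(\<Sum>k<n. int (Suc k) ^ 3 * (signed_pair_prod (Suc k) - signed_pair_prod k))
      = (\<Sum>k<n. E k) - int n ^ 2 * (T * X)"
    by (simp add: E_def X_def sum_distrib_left sum.distrib mult_ac del: of_nat_Suc)
  finally have sum_eq: "(\<Sum>k<n. (3 * int k ^ 2 + 3 * int k + 1) * signed_pair_prod k)
      = int n ^ 3 * signed_pair_prod n - ((\<Sum>k<n. E k) - int n ^ 2 * (T * X))" .
  have "g * (\<Sum>k<n. (3 * int k ^ 2 + 3 * int k + 1) * signed_pair_prod k)
      = g * (int n ^ 3 * signed_pair_prod n) - g * (\<Sum>k<n. E k) + int n ^ 2 * (g * (T * X))"
    unfolding sum_eq by (simp only: algebra_simps)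
  moreover have "int n ^ 3 dvd (\<Sum>k<n. E k)"
    unfolding E_def T_def by (intro dvd_sum signed_pair_prod_diff_second_order)
  \<comment> \<open>Each \<open>a i ^ 2 - a i\<close> is even, so a gcd formed with \<open>S\<close>
    also serves the coefficient \<open>T\<close>.\<close>
  moreover have "even (S - T)"
    unfolding S_def T_def sum_subtractf[symmetric] by (intro dvd_sum) simp
  then have "int n dvd g * (T * X)"
    unfolding g_def X_def by (rule dvd_gcd_mult_sum_linear[OF signed_pair_prod_diff])
  then have "int n ^ 2 * int n dvd int n ^ 2 * (g * (T * X))"
    by (rule mult_dvd_mono[OF dvd_refl])
  then have "int n ^ 3 dvd int n ^ 2 * (g * (T * X))"
    by (simp add: power3_eq_cube power2_eq_square)
  ultimately show ?thesis unfolding g_def S_def by simp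
qed

end

text \<open>The sign inside \<open>signed_prod\<close> is a \<open>k\<close>-th power, so it merges
  with \<open>s ^ k\<close>.\<close>

lemma sign_mult_prod_eq:
  "s ^ k * f * (\<Prod>i=1..m. int_gchoose (a i * int n - 1) k) = (s * (-1) ^ m) ^ k * f * signed_prod m n a k"
proof -
  have "((-1) ^ m) ^ k * (-1) ^ (k * m) = (1 :: int)"
    by (simp add: power_mult[symmetric] mult.commute[of k] power_add[symmetric])
  then show ?thesis
    unfolding signed_prod_eq power_mult_distrib by (simp add: mult_ac)
qed

section \<open>Rational weights\<close>

lemma binomial_middle: "Suc (2 * k) choose Suc k = Suc (2 * k) choose k"
proof -
  have "Suc (2 * k) - Suc k = k" "Suc k \<le> Suc (2 * k)" by simp_all
  then show ?thesis using binomial_symmetric[of "Suc k" "Suc (2 * k)"] by (simp only:)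
qed

lemma central_binomial_Suc: "2 * Suc k choose Suc k = 2 * (Suc (2 * k) choose k)"
proof -
  have "2 * Suc k choose Suc k = Suc (Suc (2 * k)) choose Suc k" by (simp only: mult_Suc_right add_2_eq_Suc)
  also have "\<dots> = 2 * (Suc (2 * k) choose k)" unfolding binomial_Suc_Suc[of "Suc (2 * k)"] binomial_middle by (rule mult_2[symmetric])
  finally show ?thesis .
qed

lemma Suc_mult_binomial_middle: "Suc k * (Suc (2 * k) choose k) = (2 * k + 1) * (2 * k choose k)"
  using Suc_times_binomial[of k "2 * k"] unfolding binomial_middle by simp

lemma sbinom_pos:
  assumes "0 < n"
  shows "sbinom (int n) k = (-1) ^ k * int ((n - 1) choose k)"
proof -
  have n: "of_int (int n - 1) = (of_nat (n - 1) :: rat)" using assms by (simp add: of_nat_diff)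
  have "(of_int (int_gchoose (int n - 1) k) :: rat) = of_int (int ((n - 1) choose k))"
    unfolding of_int_int_gchoose n of_int_of_nat_eq by (rule binomial_gbinomial[symmetric])
  then show ?thesis unfolding of_int_eq_iff sbinom_def by simp
qed

lemma sbinom_uminus: "sbinom (- int n) k = int ((n + k) choose k)"
proof -
  have k: "of_nat k - of_int (- int n - 1) - 1 = (of_nat (n + k) :: rat)" by simp
  have "(of_int (int_gchoose (- int n - 1) k) :: rat) = (-1) ^ k * of_nat ((n + k) choose k)"
    unfolding of_int_int_gchoose gbinomial_negated_upper[of "of_int (- int n - 1)"] k binomial_gbinomial ..
  then have "(of_int (int_gchoose (- int n - 1) k) :: rat) = of_int ((-1) ^ k * int ((n + k) choose k))"
    by simp
  then have "int_gchoose (- int n - 1) k = (-1) ^ k * int ((n + k) choose k)"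
    unfolding of_int_eq_iff .
  then show ?thesis by (simp add: sbinom_def power_mult_distrib[symmetric])
qed

text \<open>Absorption gives the claim after multiplication by \<open>k + 1\<close>, which is
  coprime to \<open>2 k + 1\<close> because \<open>2 (k + 1) - (2 k + 1) = 1\<close>.\<close>

lemma odd_dvd_binomial: "2 * k + 1 dvd Suc (2 * k) choose k"
proof -
  have "2 * k + 1 dvd Suc k * (Suc (2 * k) choose k)"
    unfolding Suc_mult_binomial_middle by (rule dvd_triv_left)
  moreover have "coprime (2 * k + 1) (Suc k)"
  proof (rule coprimeI)
    fix c assume "c dvd 2 * k + 1" "c dvd Suc k"
    then have "c dvd 2 * Suc k - (2 * k + 1)" by (metis dvd_diff_nat dvd_mult)
    then show "is_unit c" by simp
  qed
  ultimately show ?thesis using coprime_dvd_mult_right_iff by blast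
qed

text \<open>The quotient is the Catalan number.\<close>

lemma Suc_dvd_central_binomial: "Suc k dvd 2 * k choose k"
proof -
  have "Suc k * (2 * k choose Suc k) = k * (2 * k choose k)"
  proof -
    have "2 * k - k = k" by simp
    then show ?thesis
      using binomial_absorb_comp[of "2 * k" k] binomial_absorption[of k "2 * k"] by (simp only:)
  qed
  then have "Suc k dvd k * (2 * k choose k)" by (metis dvd_triv_left)
  then show ?thesis using coprime_dvd_mult_right_iff[of "Suc k" k] by simp
qed

text \<open>The denominator is \<open>2 l - 1\<close> at \<open>l = Suc k\<close>, the index at
  which summation by parts evaluates the indefinite sum.\<close>

lemma binomial_div_odd_int: "1 / (2 * of_nat (Suc k) - 1) * of_nat (Suc (2 * k) choose k) \<in> (\<int> :: rat set)"
proof -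
  obtain t where "Suc (2 * k) choose k = (2 * k + 1) * t" using odd_dvd_binomial[of k] ..
  then have "of_nat (Suc (2 * k) choose k) = (of_nat ((2 * k + 1) * t) :: rat)" by (rule arg_cong)
  also have "\<dots> = (2 * of_nat (Suc k) - 1) * of_nat t" by (simp add: algebra_simps)
  finally have "1 / (2 * of_nat (Suc k) - 1) * of_nat (Suc (2 * k) choose k)
      = 1 / (2 * of_nat (Suc k) - 1) * ((2 * of_nat (Suc k) - 1) * (of_nat t :: rat))"
    by (rule arg_cong)
  also have "\<dots> = of_nat t" by (simp add: add_nonneg_eq_0_iff)
  finally show ?thesis by simp
qed

lemma twice_binomial_div_int: "2 / (of_nat (Suc k) + 1) * of_nat (Suc (2 * k) choose k) \<in> (\<int> :: rat set)"
proof -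
  obtain t where t: "2 * Suc k choose Suc k = Suc (Suc k) * t" using Suc_dvd_central_binomial[of "Suc k"] ..
  have "of_nat (2 * (Suc (2 * k) choose k)) = (of_nat (Suc (Suc k) * t) :: rat)"
    unfolding central_binomial_Suc[symmetric] t ..
  then have "2 * of_nat (Suc (2 * k) choose k) = (of_nat (Suc k) + 1) * (of_nat t :: rat)"
    by (simp only: of_nat_mult of_nat_numeral of_nat_Suc[of "Suc k"] add.commute)
  then have "2 / (of_nat (Suc k) + 1) * of_nat (Suc (2 * k) choose k)
      = ((of_nat (Suc k) + 1) * of_nat t) / (of_nat (Suc k) + 1 :: rat)"
    by (simp only: times_divide_eq_left)
  also have "\<dots> = of_nat t" by (simp add: add_nonneg_eq_0_iff)
  finally show ?thesis by simp
qed

lemma Ints_neg_one_power: "(-1) ^ k \<in> \<int>"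
  by (intro Ints_power Ints_minus Ints_1)

text \<open>Parity is used rather than positivity, as the value at \<open>k = 0\<close> is
  -1.\<close>

lemma two_mult_minus_1_neq_0: "2 * of_nat k - 1 \<noteq> (0 :: rat)"
proof
  assume "2 * of_nat k - 1 = (0 :: rat)"
  then have "(of_int (2 * int k - 1) :: rat) = of_int 0" by simp
  then have "2 * int k - 1 = 0" unfolding of_int_eq_iff .
  then show False by presburger
qed

lemma of_nat_plus_neq_0:
  "2 * of_nat k + 1 \<noteq> (0 :: rat)" "of_nat k + 1 \<noteq> (0 :: rat)" "of_nat k + 2 \<noteq> (0 :: rat)"
  by (simp_all add: add_nonneg_eq_0_iff)

lemma four_square_minus_1: "4 * of_nat k ^ 2 - 1 = (2 * of_nat k - 1) * (2 * of_nat k + 1 :: rat)"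
  by (simp add: algebra_simps power2_eq_square)

lemma of_nat_choose_two: "of_nat ((k + 2) choose 2) = (of_nat k + 1) * (of_nat k + 2) / (2 :: rat)"
proof -
  have "2 * ((k + 2) choose 2) = (k + 2) * (k + 1)"
    using binomial_absorption[of 1 "k + 2"] by (simp add: numeral_2_eq_2)
  then have "of_nat (2 * ((k + 2) choose 2)) = (of_nat ((k + 2) * (k + 1)) :: rat)"
    by (rule arg_cong)
  then have "2 * of_nat ((k + 2) choose 2) = (of_nat k + 2) * (of_nat k + 1 :: rat)"
    by (simp only: of_nat_mult of_nat_add of_nat_1 of_nat_numeral)
  then have "of_nat ((k + 2) choose 2) = (of_nat k + 2) * (of_nat k + 1) / (2 :: rat)"
    by (simp only: mult.commute[of 2] eq_divide_eq_numeral1 split: if_split) simp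
  then show ?thesis by (simp only: mult.commute)
qed

lemma central_binomial_rat:
  "of_nat (2 * k choose k) \<noteq> (0 :: rat)"
  "of_nat (2 * Suc k choose Suc k) = 2 * (2 * of_nat k + 1) / (of_nat k + 1) * (of_nat (2 * k choose k) :: rat)"
proof -
  show "of_nat (2 * k choose k) \<noteq> (0 :: rat)" by simp
  have "of_nat (Suc k * (Suc (2 * k) choose k)) = (of_nat ((2 * k + 1) * (2 * k choose k)) :: rat)"
    unfolding Suc_mult_binomial_middle ..
  then have "(of_nat k + 1) * of_nat (Suc (2 * k) choose k) = (2 * of_nat k + 1) * (of_nat (2 * k choose k) :: rat)"
    by (simp only: of_nat_mult of_nat_Suc of_nat_add of_nat_1 of_nat_numeral add.commute)
  then show "of_nat (2 * Suc k choose Suc k) = 2 * (2 * of_nat k + 1) / (of_nat k + 1) * (of_nat (2 * k choose k) :: rat)"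
    unfolding central_binomial_Suc using of_nat_plus_neq_0(2)[of k] by (simp add: field_simps del: binomial_Suc_Suc)
qed

section \<open>The sequences with upper arguments \<open>n - 1\<close> and
  \<open>- n - 1\<close>\<close>

context
  fixes n :: nat and u v :: "nat \<Rightarrow> int"
  defines "u \<equiv> sbinom (int n)" and "v \<equiv> sbinom (- int n)"
  assumes n_pos: "0 < n"
begin

text \<open>This removes the boundary term of summation by parts.\<close>

lemma u_n: "u n = 0"
  using n_pos by (simp add: u_def sbinom_pos)

lemma u_diff: "u k - u (Suc k) = (-1) ^ k * int (n choose Suc k)"
  unfolding u_def sbinom_pos[OF n_pos] binomial_addition_formula[OF n_pos, of k] by (simp add: algebra_simps)

lemma v_diff: "v (Suc k) - v k = int ((n + k) choose Suc k)"
  by (simp add: v_def sbinom_uminus)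

text \<open>Up to sign, both sides are the multinomial coefficient
  \<open>(n + k)! / (k! (k + 1)! (n - 1 - k)!)\<close>.\<close>

lemma u_mult_v_diff: "u k * (v (Suc k) - v k) = (-1) ^ k * int ((Suc (2 * k) choose k) * ((n + k) choose Suc (2 * k)))"
proof -
  have "((n - 1) choose k) * ((n + k) choose Suc k) = (Suc (2 * k) choose k) * ((n + k) choose Suc (2 * k))"
  proof (cases "Suc k \<le> n")
    case True
    then have "((n + k) choose Suc (2 * k)) * (Suc (2 * k) choose Suc k)
        = ((n + k) choose Suc k) * ((n + k - Suc k) choose (Suc (2 * k) - Suc k))"
      by (intro choose_mult) simp_all
    moreover have "Suc (2 * k) - Suc k = k" "n + k - Suc k = n - 1" by simp_all
    ultimately show ?thesis 
      by (simp only: binomial_middle mult.commute[of "(n - 1) choose k"] mult.commute[of "Suc (2 * k) choose k"])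
  \<comment> \<open>For \<open>k\<close> \<ge> \<open>n\<close> both products vanish.\<close>
  qed (use n_pos in \<open>simp add: binomial_eq_0 del: binomial_Suc_Suc\<close>)
  then show ?thesis unfolding v_diff u_def sbinom_pos[OF n_pos]
    by (simp only: mult.assoc of_nat_mult[symmetric])
qed

lemma Suc_mult_u_diff: "int (Suc k) * (u k - u (Suc k)) = int n * u k"
  using sbinom_diff[of k "int n"] by (simp add: u_def algebra_simps)

text \<open>Both sides equal \<open>n * u k * v k / (k + 1)\<close>.\<close>

lemma v_mult_u_diff: "v k * (u k - u (Suc k)) = u k * (v (Suc k) - v k)"
proof -
  have v: "int (Suc k) * (v (Suc k) - v k) = int n * v k"
    using sbinom_diff[of k "- int n"] by (simp add: v_def)
  have "int (Suc k) * (v k * (u k - u (Suc k))) = int (Suc k) * (u k * (v (Suc k) - v k))"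
    unfolding mult.left_commute[of "int (Suc k)"] Suc_mult_u_diff v by simp
  then show ?thesis unfolding mult_cancel_left by simp
qed

lemma v_Suc_mult_u_diff:
  "v (Suc k) * (u k - u (Suc k)) = (-1) ^ k * int ((2 * Suc k choose Suc k) * ((n + Suc k) choose (2 * Suc k)))"
proof -
  have "(n choose Suc k) * ((n + Suc k) choose Suc k) = (2 * Suc k choose Suc k) * ((n + Suc k) choose (2 * Suc k))"
  proof (cases "Suc k \<le> n")
    case True
    then have "((n + Suc k) choose (2 * Suc k)) * (2 * Suc k choose Suc k)
        = ((n + Suc k) choose Suc k) * ((n + Suc k - Suc k) choose (2 * Suc k - Suc k))"
      by (intro choose_mult) simp_all
    moreover have "2 * Suc k - Suc k = Suc k" "n + Suc k - Suc k = n" by simp_all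
    ultimately show ?thesis by (simp only: mult.commute)
  qed (simp add: binomial_eq_0 del: binomial_Suc_Suc)
  then have "int (n choose Suc k) * int ((n + Suc k) choose Suc k)
      = int ((2 * Suc k choose Suc k) * ((n + Suc k) choose (2 * Suc k)))"
    by (simp only: of_nat_mult[symmetric])
  moreover have "v (Suc k) * (u k - u (Suc k)) = (-1) ^ k * (int (n choose Suc k) * int ((n + Suc k) choose Suc k))"
    unfolding u_diff v_def sbinom_uminus by (simp only: mult_ac)
  ultimately show ?thesis by (simp only:)
qed

text \<open>Change \<open>v\<close> first, then \<open>u\<close>. Positive exponents leave a factor
  \<open>u k\<close>, respectively \<open>v (Suc k)\<close>, to pair with the difference of the
  other sequence.\<close>

lemma binomial_dvd_pow_mult_diff:
  assumes "0 < a" "0 < b"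
  shows "int (Suc (2 * k) choose k) dvd u (Suc k) ^ a * v (Suc k) ^ b - u k ^ a * v k ^ b"
proof -
  define c where "c = int (Suc (2 * k) choose k)"
  have 1: "c dvd u k * (v (Suc k) - v k)"
    unfolding u_mult_v_diff c_def by simp
  have "int (2 * Suc k choose Suc k) = 2 * c"
    unfolding c_def central_binomial_Suc by simp
  then have 2: "c dvd v (Suc k) * (u k - u (Suc k))"
    unfolding v_Suc_mult_u_diff of_nat_mult by simp
  have "c dvd u k ^ a * (v (Suc k) ^ b - v k ^ b)"
  proof -
    have "u k * (v (Suc k) - v k) dvd u k ^ a * (v (Suc k) ^ b - v k ^ b)"
      by (rule mult_dvd_mono) (use assms in \<open>auto simp: power_diff_sumr2\<close>)
    with 1 show ?thesis by (rule dvd_trans)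
  qed
  moreover have "c dvd v (Suc k) ^ b * (u k ^ a - u (Suc k) ^ a)"
  proof -
    have "v (Suc k) * (u k - u (Suc k)) dvd v (Suc k) ^ b * (u k ^ a - u (Suc k) ^ a)"
      by (rule mult_dvd_mono) (use assms in \<open>auto simp: power_diff_sumr2\<close>)
    with 2 show ?thesis by (rule dvd_trans)
  qed
  ultimately have "c dvd u k ^ a * (v (Suc k) ^ b - v k ^ b) - v (Suc k) ^ b * (u k ^ a - u (Suc k) ^ a)"
    by (rule dvd_diff)
  then show ?thesis unfolding c_def by (simp add: algebra_simps)
qed

text \<open>By \<open>v_mult_u_diff\<close> the difference of \<open>u * v\<close> is minus the
  product of the two single differences. Multiplying by \<open>k + 1\<close> turns one of them into
  \<open>n * u k\<close>, and \<open>u k\<close> times the other contains the binomial.\<close>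

lemma n_mult_binomial_dvd_pow_diff:
  assumes "0 < a"
  shows "int n * int (Suc (2 * k) choose k) dvd int (Suc k) * ((u (Suc k) * v (Suc k)) ^ a - (u k * v k) ^ a)"
proof -
  have 1: "u (Suc k) * v (Suc k) - u k * v k = - (u k - u (Suc k)) * (v (Suc k) - v k)"
    using v_mult_u_diff[of k] by (simp add: algebra_simps)
  have "int (Suc k) * (u (Suc k) * v (Suc k) - u k * v k) = - int n * (u k * (v (Suc k) - v k))"
    unfolding 1 using Suc_mult_u_diff[of k] by (simp only: mult_minus_left mult_minus_right mult.assoc[symmetric])
  then have "int n * int (Suc (2 * k) choose k) dvd int (Suc k) * (u (Suc k) * v (Suc k) - u k * v k)"
    unfolding u_mult_v_diff by simp
  moreover have "u (Suc k) * v (Suc k) - u k * v k dvd (u (Suc k) * v (Suc k)) ^ a - (u k * v k) ^ a"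
    by (simp add: power_diff_sumr2)
  ultimately show ?thesis by (meson dvd_refl dvd_trans mult_dvd_mono)
qed

lemma weighted_sum_int:
  fixes F f :: "nat \<Rightarrow> rat"
  assumes "0 < a" "0 < b" "F 0 = 0" "\<And>k. F (Suc k) - F k = f k"
    and "\<And>k. F (Suc k) * of_nat (Suc (2 * k) choose k) \<in> \<int>"
  shows "(\<Sum>k<n. f k * of_int (u k ^ a * v k ^ b)) \<in> \<int>"
proof -
  have "F (Suc k) * (of_int (u (Suc k) ^ a * v (Suc k) ^ b) - of_int (u k ^ a * v k ^ b)) \<in> \<int>" for k
  proof -
    obtain t where t: "u (Suc k) ^ a * v (Suc k) ^ b - u k ^ a * v k ^ b = int (Suc (2 * k) choose k) * t"
      using binomial_dvd_pow_mult_diff[OF assms(1,2), of k] ..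
    have "F (Suc k) * of_int (u (Suc k) ^ a * v (Suc k) ^ b - u k ^ a * v k ^ b)
        = (F (Suc k) * of_nat (Suc (2 * k) choose k)) * of_int t"
      unfolding t by (simp only: of_int_mult of_int_of_nat_eq mult.assoc)
    also have "\<dots> \<in> \<int>" by (rule Ints_mult[OF assms(5) Ints_of_int])
    finally show ?thesis by (simp only: of_int_diff)
  qed
  then show ?thesis
    unfolding sum_by_parts[of F f, OF assms(3,4)] using u_n assms(1)
    by (intro Ints_diff Ints_sum) (auto simp: zero_power)
qed

text \<open>The indefinite sum has the form \<open>k * G k\<close>; its factor \<open>k + 1\<close>
  at \<open>Suc k\<close> is what extracts \<open>n\<close> from the difference.\<close>

lemma divided_weighted_sum_int:
  fixes G f :: "nat \<Rightarrow> rat"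
  assumes "0 < a" "\<And>k. of_nat (Suc k) * G (Suc k) - of_nat k * G k = f k"
    and "\<And>k. G (Suc k) * of_nat (Suc (2 * k) choose k) \<in> \<int>"
  shows "1 / of_nat n * (\<Sum>k<n. f k * of_int ((u k * v k) ^ a)) \<in> \<int>"
proof -
  have "1 / of_nat n * (of_nat (Suc k) * G (Suc k)
      * (of_int ((u (Suc k) * v (Suc k)) ^ a) - of_int ((u k * v k) ^ a))) \<in> \<int>" for k
  proof -
    obtain t where t: "int (Suc k) * ((u (Suc k) * v (Suc k)) ^ a - (u k * v k) ^ a)
        = int n * int (Suc (2 * k) choose k) * t"
      using n_mult_binomial_dvd_pow_diff[OF assms(1), of k] ..
    have "of_int (int j * (A - B)) = (of_nat j * (of_int A - of_int B) :: rat)" for j A B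
      by simp
    then have "1 / of_nat n * (of_nat (Suc k) * G (Suc k)
          * (of_int ((u (Suc k) * v (Suc k)) ^ a) - of_int ((u k * v k) ^ a)))
        = 1 / of_nat n * G (Suc k) * of_int (int (Suc k) * ((u (Suc k) * v (Suc k)) ^ a - (u k * v k) ^ a))"
      by (simp only: mult_ac)
    also have "\<dots> = (G (Suc k) * of_nat (Suc (2 * k) choose k)) * of_int t"
    proof -
      have "1 / of_nat n * g * of_int (int n * int c * t) = g * of_nat c * of_int t" for g :: rat and c
        using n_pos by simp
      then show ?thesis unfolding t .
    qed
    also have "\<dots> \<in> \<int>" by (rule Ints_mult[OF assms(3) Ints_of_int])
    finally show ?thesis .
  qed
  then have "- (\<Sum>k<n. 1 / of_nat n * (of_nat (Suc k) * G (Suc k)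
      * (of_int ((u (Suc k) * v (Suc k)) ^ a) - of_int ((u k * v k) ^ a)))) \<in> \<int>"
    by (intro Ints_minus Ints_sum)
  moreover have "(\<Sum>k<n. f k * of_int ((u k * v k) ^ a))
      = of_nat n * G n * of_int ((u n * v n) ^ a) - (\<Sum>k<n. of_nat (Suc k) * G (Suc k)
         * (of_int ((u (Suc k) * v (Suc k)) ^ a) - of_int ((u k * v k) ^ a)))"
    by (rule sum_by_parts[where F = "\<lambda>k. of_nat k * G k"]) (use assms(2) in simp_all)
  ultimately show ?thesis
    using u_n assms(1) by (simp add: sum_distrib_left zero_power del: of_nat_Suc)
qed

section \<open>Weights in the sums divided by \<open>n\<close>\<close>

lemma divided_sum_odd_weight_int:
  assumes "0 < a"
  shows "1 / of_nat n * (\<Sum>k<n. 1 / (4 * of_nat k ^ 2 - 1) * of_int ((u k * v k) ^ a)) \<in> (\<int> :: rat set)"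
\<comment> \<open>Partial fractions give \<open>- 1 / (2 (2 l - 1))\<close>; the added constant
  \<open>- 1 / 2\<close> makes it vanish at 0 and yields the factor \<open>l\<close>.\<close>
proof (rule divided_weighted_sum_int[OF assms, where G = "\<lambda>l. (-1) * (1 / (2 * of_nat l - 1))"])
  show "of_nat (Suc k) * ((-1) * (1 / (2 * of_nat (Suc k) - 1))) - of_nat k * ((-1) * (1 / (2 * of_nat k - 1)))
      = (1 / (4 * of_nat k ^ 2 - 1) :: rat)" for k
    unfolding four_square_minus_1 using two_mult_minus_1_neq_0[of k] of_nat_plus_neq_0(1)[of k]
    by (simp add: divide_simps) (simp add: algebra_simps)
  show "(-1) * (1 / (2 * of_nat (Suc k) - 1)) * of_nat (Suc (2 * k) choose k) \<in> (\<int> :: rat set)" for k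
    unfolding mult.assoc by (intro Ints_mult binomial_div_odd_int Ints_minus Ints_1)
qed

lemma divided_sum_triangle_weight_int:
  assumes "0 < a"
  shows "1 / of_nat n * (\<Sum>k<n. 1 / of_nat ((k + 2) choose 2) * of_int ((u k * v k) ^ a)) \<in> (\<int> :: rat set)"
proof (rule divided_weighted_sum_int[OF assms, where G = "\<lambda>l. 2 / (of_nat l + 1)"])
  show "of_nat (Suc k) * (2 / (of_nat (Suc k) + 1)) - of_nat k * (2 / (of_nat k + 1))
      = (1 / of_nat ((k + 2) choose 2) :: rat)" for k
    unfolding of_nat_choose_two using of_nat_plus_neq_0[of k]
    by (simp add: divide_simps) (simp add: algebra_simps)
  show "2 / (of_nat (Suc k) + 1) * of_nat (Suc (2 * k) choose k) \<in> (\<int> :: rat set)" for k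
    by (rule twice_binomial_div_int)
qed

lemma divided_alternating_sum_odd_weight_int:
  assumes "0 < a"
  shows "1 / of_nat n * (\<Sum>k<n. (-1) ^ k * (1 + 2 * of_nat k / (4 * of_nat k ^ 2 - 1)) * of_int ((u k * v k) ^ a))
    \<in> (\<int> :: rat set)"
proof (rule divided_weighted_sum_int[OF assms, where G = "\<lambda>l. (-1) ^ Suc l * (1 / (2 * of_nat l - 1))"])
  show "of_nat (Suc k) * ((-1) ^ Suc (Suc k) * (1 / (2 * of_nat (Suc k) - 1))) - of_nat k * ((-1) ^ Suc k * (1 / (2 * of_nat k - 1)))
      = ((-1) ^ k * (1 + 2 * of_nat k / (4 * of_nat k ^ 2 - 1)) :: rat)" for k
    unfolding four_square_minus_1 using two_mult_minus_1_neq_0[of k] of_nat_plus_neq_0(1)[of k]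
    by (simp add: divide_simps) (simp add: algebra_simps)
  show "(-1) ^ Suc (Suc k) * (1 / (2 * of_nat (Suc k) - 1)) * of_nat (Suc (2 * k) choose k) \<in> (\<int> :: rat set)" for k
    unfolding mult.assoc by (intro Ints_mult binomial_div_odd_int Ints_neg_one_power)
qed

lemma divided_alternating_sum_triangle_weight_int:
  assumes "0 < a"
  shows "1 / of_nat n * (\<Sum>k<n. (-1) ^ k * (4 - (2 * of_nat k + 3) / of_nat ((k + 2) choose 2)) * of_int ((u k * v k) ^ a))
    \<in> (\<int> :: rat set)"
\<comment> \<open>\<open>2 (k + 1) / (k + 2) + 2 k / (k + 1) = 4 - 2 / (k + 2) - 2 / (k +
  1)\<close>.\<close>
proof (rule divided_weighted_sum_int[OF assms, where G = "\<lambda>l. (-1) ^ Suc l * (2 / (of_nat l + 1))"])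
  show "of_nat (Suc k) * ((-1) ^ Suc (Suc k) * (2 / (of_nat (Suc k) + 1))) - of_nat k * ((-1) ^ Suc k * (2 / (of_nat k + 1)))
      = ((-1) ^ k * (4 - (2 * of_nat k + 3) / of_nat ((k + 2) choose 2)) :: rat)" for k
    unfolding of_nat_choose_two using of_nat_plus_neq_0[of k]
    by (simp add: divide_simps) (simp add: algebra_simps)
  show "(-1) ^ Suc (Suc k) * (2 / (of_nat (Suc k) + 1)) * of_nat (Suc (2 * k) choose k) \<in> (\<int> :: rat set)" for k
    unfolding mult.assoc by (intro Ints_mult twice_binomial_div_int Ints_neg_one_power)
qed

section \<open>Weights in the sums with independent exponents\<close>

context
  fixes a b :: nat
  assumes a_pos: "0 < a" and b_pos: "0 < b"
begin

lemma sum_odd_weight_int: "(\<Sum>k<n. 1 / (4 * of_nat k ^ 2 - 1) * of_int (u k ^ a * v k ^ b)) \<in> (\<int> :: rat set)"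
proof (rule weighted_sum_int[OF a_pos b_pos, where F = "\<lambda>l. - of_nat l * (1 / (2 * of_nat l - 1))"])
  show "- of_nat (Suc k) * (1 / (2 * of_nat (Suc k) - 1)) - - of_nat k * (1 / (2 * of_nat k - 1))
      = (1 / (4 * of_nat k ^ 2 - 1) :: rat)" for k
    unfolding four_square_minus_1 using two_mult_minus_1_neq_0[of k] of_nat_plus_neq_0(1)[of k]
    by (simp add: divide_simps) (simp add: algebra_simps)
  show "- of_nat (Suc k) * (1 / (2 * of_nat (Suc k) - 1)) * of_nat (Suc (2 * k) choose k) \<in> (\<int> :: rat set)" for k
    unfolding mult.assoc by (intro Ints_mult binomial_div_odd_int Ints_minus Ints_of_nat)
qed simp

lemma alternating_sum_odd_weight_int:
  "(\<Sum>k<n. (-1) ^ k * of_nat k / (4 * of_nat k ^ 2 - 1) * of_int (u k ^ a * v k ^ b)) \<in> (\<int> :: rat set)"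
\<comment> \<open>The weight is \<open>(-1)^k (1 / (2 k - 1) + 1 / (2 k + 1)) / 4\<close>, which
  telescopes; the constant \<open>- 1 / 4\<close> is added to make \<open>F 0 = 0\<close>.\<close>
proof (rule weighted_sum_int[OF a_pos b_pos,
      where F = "\<lambda>l. - (((-1) ^ l + (2 * of_nat l - 1)) / 4) * (1 / (2 * of_nat l - 1))"])
  show "- (((-1) ^ Suc k + (2 * of_nat (Suc k) - 1)) / 4) * (1 / (2 * of_nat (Suc k) - 1))
      - - (((-1) ^ k + (2 * of_nat k - 1)) / 4) * (1 / (2 * of_nat k - 1))
      = ((-1) ^ k * of_nat k / (4 * of_nat k ^ 2 - 1) :: rat)" for k
    unfolding four_square_minus_1 using two_mult_minus_1_neq_0[of k] of_nat_plus_neq_0(1)[of k]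
    by (simp add: divide_simps) (simp add: algebra_simps)
  show "- (((-1) ^ Suc k + (2 * of_nat (Suc k) - 1)) / 4) * (1 / (2 * of_nat (Suc k) - 1)) * of_nat (Suc (2 * k) choose k)
      \<in> (\<int> :: rat set)" for k
  proof -
    \<comment> \<open>For either parity of \<open>k\<close>, \<open>2 k + 1 - (-1)^k\<close> is a
      multiple of 4.\<close>
    have "((-1) ^ Suc k + (2 * of_nat (Suc k) - 1)) / 4 \<in> (\<int> :: rat set)"
    proof (cases "even k")
      case True
      then obtain j where "k = 2 * j" ..
      then have "((-1) ^ Suc k + (2 * of_nat (Suc k) - 1)) / 4 = (of_nat j :: rat)" by simp
      then show ?thesis by simp
    next
      case False
      then obtain j where "k = 2 * j + 1" by (rule oddE)
      then have "((-1) ^ Suc k + (2 * of_nat (Suc k) - 1)) / 4 = (of_nat (Suc j) :: rat)" by simp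
      then show ?thesis by (metis Ints_of_nat)
    qed
    from Ints_mult[OF Ints_minus[OF this] binomial_div_odd_int[of k]] show ?thesis
      unfolding mult.assoc .
  qed
qed simp

lemma sum_triangle_weight_int:
  "(\<Sum>k<n. 1 / of_nat ((k + 2) choose 2) * of_int (u k ^ a * v k ^ b)) \<in> (\<int> :: rat set)"
proof (rule weighted_sum_int[OF a_pos b_pos, where F = "\<lambda>l. of_nat l * (2 / (of_nat l + 1))"])
  show "of_nat (Suc k) * (2 / (of_nat (Suc k) + 1)) - of_nat k * (2 / (of_nat k + 1))
      = (1 / of_nat ((k + 2) choose 2) :: rat)" for k
    unfolding of_nat_choose_two using of_nat_plus_neq_0[of k]
    by (simp add: divide_simps) (simp add: algebra_simps)
  show "of_nat (Suc k) * (2 / (of_nat (Suc k) + 1)) * of_nat (Suc (2 * k) choose k) \<in> (\<int> :: rat set)" for k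
    unfolding mult.assoc by (intro Ints_mult twice_binomial_div_int Ints_of_nat)
qed simp

lemma alternating_sum_triangle_weight_int:
  "(\<Sum>k<n. (-1) ^ k * (2 * of_nat k + 3) / of_nat ((k + 2) choose 2) * of_int (u k ^ a * v k ^ b)) \<in> (\<int> :: rat set)"
\<comment> \<open>The unsigned weight is \<open>2 / (k + 1) + 2 / (k + 2)\<close>, so the signed one
  telescopes to \<open>- 2 (-1)^l / (l + 1)\<close>, shifted by 2.\<close>
proof (rule weighted_sum_int[OF a_pos b_pos, where F = "\<lambda>l. (of_nat l + 1 - (-1) ^ l) * (2 / (of_nat l + 1))"])
  show "(of_nat (Suc k) + 1 - (-1) ^ Suc k) * (2 / (of_nat (Suc k) + 1)) - (of_nat k + 1 - (-1) ^ k) * (2 / (of_nat k + 1))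
      = ((-1) ^ k * (2 * of_nat k + 3) / of_nat ((k + 2) choose 2) :: rat)" for k
    unfolding of_nat_choose_two using of_nat_plus_neq_0[of k]
    by (simp add: divide_simps) (simp add: algebra_simps)
  show "(of_nat (Suc k) + 1 - (-1) ^ Suc k) * (2 / (of_nat (Suc k) + 1)) * of_nat (Suc (2 * k) choose k)
      \<in> (\<int> :: rat set)" for k
    unfolding mult.assoc
    by (intro Ints_mult twice_binomial_div_int Ints_diff Ints_add Ints_of_nat Ints_1 Ints_neg_one_power)
qed simp

text \<open>The central binomial is twice the middle one, so the denominator cancels. The free
  exponent \<open>l\<close> covers the plain and the alternating weight.\<close>

lemma signed_central_binomial_weight_int:
  "2 * (1 - (-1) ^ l / of_nat (2 * Suc k choose Suc k)) * of_nat (Suc (2 * k) choose k) \<in> (\<int> :: rat set)"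
proof -
  have "2 * (1 - (-1) ^ l / of_nat (2 * Suc k choose Suc k)) * of_nat (Suc (2 * k) choose k)
      = 2 * of_nat (Suc (2 * k) choose k) - ((-1) ^ l :: rat)"
    unfolding central_binomial_Suc by (simp add: field_simps del: binomial_Suc_Suc)
  also have "\<dots> \<in> \<int>" by (intro Ints_diff Ints_mult Ints_numeral Ints_of_nat Ints_power Ints_minus Ints_1)
  finally show ?thesis .
qed

lemma sum_central_binomial_weight_int:
  "(\<Sum>k<n. (3 * of_nat k + 1) / ((2 * of_nat k + 1) * of_nat ((2 * k) choose k)) * of_int (u k ^ a * v k ^ b))
    \<in> (\<int> :: rat set)"
\<comment> \<open>Consecutive reciprocals have ratio \<open>(k + 1) / (2 (2 k + 1))\<close>, and
  \<open>2 - (k + 1) / (2 k + 1) = (3 k + 1) / (2 k + 1)\<close>.\<close>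
proof (rule weighted_sum_int[OF a_pos b_pos, where F = "\<lambda>l. 2 * (1 - 1 / of_nat (2 * l choose l))"])
  show "2 * (1 - 1 / of_nat (2 * Suc k choose Suc k)) - 2 * (1 - 1 / of_nat (2 * k choose k))
      = ((3 * of_nat k + 1) / ((2 * of_nat k + 1) * of_nat ((2 * k) choose k)) :: rat)" for k
    unfolding central_binomial_rat(2) using central_binomial_rat(1)[of k] of_nat_plus_neq_0(1,2)[of k]
    by (simp add: divide_simps) (simp add: algebra_simps)
  show "2 * (1 - 1 / of_nat (2 * Suc k choose Suc k)) * of_nat (Suc (2 * k) choose k) \<in> (\<int> :: rat set)" for k
    using signed_central_binomial_weight_int[of 0 k] by (simp only: power_0)
qed simp

lemma alternating_sum_central_binomial_weight_int:
  "(\<Sum>k<n. (-1) ^ k * (5 * of_nat k + 3) / ((2 * of_nat k + 1) * of_nat ((2 * k) choose k)) * of_int (u k ^ a * v k ^ b))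
    \<in> (\<int> :: rat set)"
\<comment> \<open>With alternating signs the reciprocals add:
  \<open>2 + (k + 1) / (2 k + 1) = (5 k + 3) / (2 k + 1)\<close>.\<close>
proof (rule weighted_sum_int[OF a_pos b_pos, where F = "\<lambda>l. 2 * (1 - (-1) ^ l / of_nat (2 * l choose l))"])
  show "2 * (1 - (-1) ^ Suc k / of_nat (2 * Suc k choose Suc k)) - 2 * (1 - (-1) ^ k / of_nat (2 * k choose k))
      = ((-1) ^ k * (5 * of_nat k + 3) / ((2 * of_nat k + 1) * of_nat ((2 * k) choose k)) :: rat)" for k
    unfolding central_binomial_rat(2) using central_binomial_rat(1)[of k] of_nat_plus_neq_0(1,2)[of k]
    by (simp add: divide_simps) (simp add: algebra_simps)
qed (simp_all only: signed_central_binomial_weight_int, simp)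

end

section \<open>Translation to rational generalized binomial coefficients\<close>

lemma gchoose_eq_u: "(of_nat n - 1 :: rat) gchoose k = (-1) ^ k * of_int (u k)"
  by (simp add: u_def sbinom_def of_int_int_gchoose power_mult_distrib[symmetric])

lemma gchoose_eq_v: "(- of_nat n - 1 :: rat) gchoose k = (-1) ^ k * of_int (v k)"
  by (simp add: v_def sbinom_def of_int_int_gchoose power_mult_distrib[symmetric])

lemma gchoose_powers:
  "((of_nat n - 1 :: rat) gchoose k) ^ a * ((- of_nat n - 1) gchoose k) ^ b
    = (-1) ^ ((a + b) * k) * of_int (u k ^ a * v k ^ b)"
proof -
  have "(-1 :: rat) ^ ((a + b) * k) = ((-1) ^ k) ^ a * ((-1) ^ k) ^ b"
    by (simp only: mult.commute[of "a + b"] power_mult power_add)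
  then show ?thesis
    unfolding gchoose_eq_u gchoose_eq_v
    by (simp only: power_mult_distrib of_int_mult of_int_power mult_ac)
qed

lemma gchoose_pair_power:
  "((of_nat n - 1 :: rat) gchoose k) ^ a * ((- of_nat n - 1) gchoose k) ^ a = of_int ((u k * v k) ^ a)"
proof -
  have "((-1 :: rat) ^ ((a + a) * k)) = 1" by simp
  then show ?thesis unfolding gchoose_powers by (simp add: power_mult_distrib)
qed

lemma sign_mult_gchoose_powers:
  "(-1) ^ ((a + b) * k) * w * ((of_nat n - 1 :: rat) gchoose k) ^ a * ((- of_nat n - 1) gchoose k) ^ b
    = w * of_int (u k ^ a * v k ^ b)"
proof -
  have "(-1 :: rat) ^ ((a + b) * k) * (-1) ^ ((a + b) * k) = 1" by (simp add: power_mult_distrib[symmetric])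
  then have "(-1) ^ ((a + b) * k) * (w * ((-1) ^ ((a + b) * k) * x)) = w * x" for x
    unfolding mult.left_commute[of w] unfolding mult.assoc[symmetric] by (simp only: mult_1)
  then show ?thesis unfolding mult.assoc gchoose_powers by (simp only: mult.assoc)
qed

text \<open>One sign \<open>(-1) ^ k\<close> survives the cancellation; \<open>0 < a\<close> keeps
  the natural subtraction exact.\<close>

lemma opposite_sign_mult_gchoose_powers:
  assumes "0 < a"
  shows "(-1) ^ ((a + b - 1) * k) * w * ((of_nat n - 1 :: rat) gchoose k) ^ a * ((- of_nat n - 1) gchoose k) ^ b
    = (-1) ^ k * w * of_int (u k ^ a * v k ^ b)"
proof -
  have "(a + b) * k = (a + b - 1) * k + k" using assms by (cases a) simp_all
  then have "(-1 :: rat) ^ ((a + b) * k) = (-1) ^ ((a + b - 1) * k) * (-1) ^ k" by (simp only: power_add)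
  then have "(-1 :: rat) ^ ((a + b - 1) * k) = (-1) ^ ((a + b) * k) * (-1) ^ k"
    by (simp add: power_mult_distrib[symmetric] mult.assoc)
  then show ?thesis
    using sign_mult_gchoose_powers[where w = "(-1) ^ k * w"] by (simp only: mult.assoc)
qed

end

theorem theorem1p5:
  shows
    "(\<forall>(m::nat) (a :: nat \<Rightarrow> int) (n::nat). 1 \<le> m \<and> 0 < n \<longrightarrow>
        (\<forall>s \<in> {1, -1 :: int}.
           [(\<Sum>k<n. s ^ k * (2 * int k + 1) * (\<Prod>i=1..m. int_gchoose (a i * int n - 1) k)) = 0]
             (mod (int n)))
      \<and> (\<forall>s \<in> {1, -1 :: int}.
           [(\<Sum>k<n. s ^ k * (4 * int k ^ 3 - 1) * (\<Prod>i=1..m. int_gchoose (a i * int n - 1) k)) = 0]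
             (mod (int n)))
      \<and> [gcd ((\<Sum>i=1..m. a i) - 1) 2 *
           (\<Sum>k<n. (-1) ^ (k * m) * (2 * int k + 1) *
              (\<Prod>i=1..m. int_gchoose (a i * int n - 1) k)) = 0]
           (mod (int n ^ 2))
      \<and> [6 *
           (\<Sum>k<n. (-1) ^ (k * m) * (3 * int k ^ 2 + 3 * int k + 1) *
              (\<Prod>i=1..m. int_gchoose (a i * int n - 1) k)) = 0]
           (mod (int n ^ 2))
      \<and> [(\<Sum>k<n. (-1) ^ k * (4 * int k ^ 3 - 1) *
              (\<Prod>i=1..m. int_gchoose (a i * int n - 1) k * int_gchoose (- a i * int n - 1) k)) = 0]
           (mod (int n ^ 2))
      \<and> [gcd ((\<Sum>i=1..m. a i) - 1) 2 *
           (\<Sum>k<n. (3 * int k ^ 2 + 3 * int k + 1) *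
              (\<Prod>i=1..m. int_gchoose (a i * int n - 1) k * int_gchoose (- a i * int n - 1) k)) = 0]
           (mod (int n ^ 3)))
   \<and>
     (\<forall>(a::nat) (b::nat) (n::nat). 0 < a \<and> 0 < b \<and> 0 < n \<longrightarrow>
        1 / rat_of_nat n *
          (\<Sum>k<n. (((rat_of_nat n - 1) gchoose k) ^ a * ((- rat_of_nat n - 1) gchoose k) ^ a)
                  / (4 * rat_of_nat k ^ 2 - 1)) \<in> \<int>
      \<and> 1 / rat_of_nat n *
          (\<Sum>k<n. (((rat_of_nat n - 1) gchoose k) ^ a * ((- rat_of_nat n - 1) gchoose k) ^ a)
                  / rat_of_nat ((k + 2) choose 2)) \<in> \<int>
      \<and> 1 / rat_of_nat n *
          (\<Sum>k<n. (-1) ^ k * (1 + 2 * rat_of_nat k / (4 * rat_of_nat k ^ 2 - 1))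
                  * ((rat_of_nat n - 1) gchoose k) ^ a
                  * ((- rat_of_nat n - 1) gchoose k) ^ a) \<in> \<int>
      \<and> 1 / rat_of_nat n *
          (\<Sum>k<n. (-1) ^ k * (4 - (2 * rat_of_nat k + 3) / rat_of_nat ((k + 2) choose 2))
                  * ((rat_of_nat n - 1) gchoose k) ^ a
                  * ((- rat_of_nat n - 1) gchoose k) ^ a) \<in> \<int>
      \<and> (\<Sum>k<n. (-1) ^ ((a + b) * k) / (4 * rat_of_nat k ^ 2 - 1)
                  * ((rat_of_nat n - 1) gchoose k) ^ a
                  * ((- rat_of_nat n - 1) gchoose k) ^ b) \<in> \<int>
      \<and> (\<Sum>k<n. (-1) ^ ((a + b - 1) * k) * rat_of_nat k / (4 * rat_of_nat k ^ 2 - 1)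
                  * ((rat_of_nat n - 1) gchoose k) ^ a
                  * ((- rat_of_nat n - 1) gchoose k) ^ b) \<in> \<int>
      \<and> (\<Sum>k<n. (-1) ^ ((a + b) * k) / rat_of_nat ((k + 2) choose 2)
                  * ((rat_of_nat n - 1) gchoose k) ^ a
                  * ((- rat_of_nat n - 1) gchoose k) ^ b) \<in> \<int>
      \<and> (\<Sum>k<n. (-1) ^ ((a + b - 1) * k) * (2 * rat_of_nat k + 3) / rat_of_nat ((k + 2) choose 2)
                  * ((rat_of_nat n - 1) gchoose k) ^ a
                  * ((- rat_of_nat n - 1) gchoose k) ^ b) \<in> \<int>
      \<and> (\<Sum>k<n. (-1) ^ ((a + b) * k) * (3 * rat_of_nat k + 1)
                    / ((2 * rat_of_nat k + 1) * rat_of_nat ((2 * k) choose k))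
                  * ((rat_of_nat n - 1) gchoose k) ^ a
                  * ((- rat_of_nat n - 1) gchoose k) ^ b) \<in> \<int>
      \<and> (\<Sum>k<n. (-1) ^ ((a + b - 1) * k) * (5 * rat_of_nat k + 3)
                    / ((2 * rat_of_nat k + 1) * rat_of_nat ((2 * k) choose k))
                  * ((rat_of_nat n - 1) gchoose k) ^ a
                  * ((- rat_of_nat n - 1) gchoose k) ^ b) \<in> \<int>)"
proof (intro conjI allI impI ballI)
  fix m n :: nat and a :: "nat \<Rightarrow> int" and s :: int
  assume "s \<in> {1, -1}"
  \<comment> \<open>Passing to signed products only permutes the two choices of sign.\<close>
  then have s: "s * (-1) ^ m \<in> {1, -1}" by (cases "even m") auto
  show "[(\<Sum>k<n. s ^ k * (2 * int k + 1) * (\<Prod>i=1..m. int_gchoose (a i * int n - 1) k)) = 0] (mod (int n))"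
    unfolding sign_mult_prod_eq cong_0_iff by (rule dvd_sum_signed_odd[OF signed_prod_diff s])
  show "[(\<Sum>k<n. s ^ k * (4 * int k ^ 3 - 1) * (\<Prod>i=1..m. int_gchoose (a i * int n - 1) k)) = 0] (mod (int n))"
    unfolding sign_mult_prod_eq cong_0_iff by (rule dvd_sum_signed_cubic[OF signed_prod_diff s])
next
  fix m n :: nat and a :: "nat \<Rightarrow> int"
  have eq: "(-1) ^ (k * m) * f * (\<Prod>i=1..m. int_gchoose (a i * int n - 1) k) = f * signed_prod m n a k" for k f
    unfolding signed_prod_eq by (simp only: mult_ac)
  show "[gcd ((\<Sum>i=1..m. a i) - 1) 2 * (\<Sum>k<n. (-1) ^ (k * m) * (2 * int k + 1) *
      (\<Prod>i=1..m. int_gchoose (a i * int n - 1) k)) = 0] (mod (int n ^ 2))"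
    unfolding eq cong_0_iff by (rule gcd_sum_odd_signed_prod)
  show "[6 * (\<Sum>k<n. (-1) ^ (k * m) * (3 * int k ^ 2 + 3 * int k + 1) *
      (\<Prod>i=1..m. int_gchoose (a i * int n - 1) k)) = 0] (mod (int n ^ 2))"
    unfolding eq cong_0_iff by (rule six_sum_cubic_signed_prod)
  show "[(\<Sum>k<n. (-1) ^ k * (4 * int k ^ 3 - 1) *
      (\<Prod>i=1..m. int_gchoose (a i * int n - 1) k * int_gchoose (- a i * int n - 1) k)) = 0] (mod (int n ^ 2))"
    unfolding signed_pair_prod_eq[symmetric] cong_0_iff by (rule alternating_sum_cubic_signed_pair_prod)
  show "[gcd ((\<Sum>i=1..m. a i) - 1) 2 * (\<Sum>k<n. (3 * int k ^ 2 + 3 * int k + 1) *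
      (\<Prod>i=1..m. int_gchoose (a i * int n - 1) k * int_gchoose (- a i * int n - 1) k)) = 0] (mod (int n ^ 3))"
    unfolding signed_pair_prod_eq[symmetric] cong_0_iff by (rule gcd_sum_cubic_signed_pair_prod)
next
  fix a b n :: nat
  assume *: "0 < a \<and> 0 < b \<and> 0 < n"
  then have a: "0 < a" and b: "0 < b" and n: "0 < n" by simp_all
  show "1 / rat_of_nat n * (\<Sum>k<n. (((rat_of_nat n - 1) gchoose k) ^ a * ((- rat_of_nat n - 1) gchoose k) ^ a)
      / (4 * rat_of_nat k ^ 2 - 1)) \<in> \<int>"
    using divided_sum_odd_weight_int[OF n a] unfolding gchoose_pair_power[OF n] by simp
  show "1 / rat_of_nat n * (\<Sum>k<n. (((rat_of_nat n - 1) gchoose k) ^ a * ((- rat_of_nat n - 1) gchoose k) ^ a)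
      / rat_of_nat ((k + 2) choose 2)) \<in> \<int>"
    using divided_sum_triangle_weight_int[OF n a] unfolding gchoose_pair_power[OF n]
    by (simp only: times_divide_eq_left mult_1)
  show "1 / rat_of_nat n * (\<Sum>k<n. (-1) ^ k * (1 + 2 * rat_of_nat k / (4 * rat_of_nat k ^ 2 - 1))
      * ((rat_of_nat n - 1) gchoose k) ^ a * ((- rat_of_nat n - 1) gchoose k) ^ a) \<in> \<int>"
    using divided_alternating_sum_odd_weight_int[OF n a]
    unfolding mult.assoc[of _ "_ ^ a" "_ ^ a"] gchoose_pair_power[OF n] .
  show "1 / rat_of_nat n * (\<Sum>k<n. (-1) ^ k * (4 - (2 * rat_of_nat k + 3) / rat_of_nat ((k + 2) choose 2))
      * ((rat_of_nat n - 1) gchoose k) ^ a * ((- rat_of_nat n - 1) gchoose k) ^ a) \<in> \<int>"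
    using divided_alternating_sum_triangle_weight_int[OF n a]
    unfolding mult.assoc[of _ "_ ^ a" "_ ^ a"] gchoose_pair_power[OF n] .
  \<comment> \<open>The weight is regrouped as a single factor after the sign, the shape the sign
    lemmas rewrite.\<close>
  have same: "(-1) ^ ((a + b) * k) / w = (-1) ^ ((a + b) * k) * (1 / w)"
    "(-1) ^ ((a + b) * k) * w' / w = (-1) ^ ((a + b) * k) * (w' / w)" for k and w w' :: rat
    by simp_all
  have opp: "(-1) ^ ((a + b - 1) * k) * w' / w = (-1) ^ ((a + b - 1) * k) * (w' / w)" for k and w w' :: rat
    by simp_all
  show "(\<Sum>k<n. (-1) ^ ((a + b) * k) / (4 * rat_of_nat k ^ 2 - 1)
      * ((rat_of_nat n - 1) gchoose k) ^ a * ((- rat_of_nat n - 1) gchoose k) ^ b) \<in> \<int>"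
    unfolding same sign_mult_gchoose_powers[OF n] by (rule sum_odd_weight_int[OF n a b])
  show "(\<Sum>k<n. (-1) ^ ((a + b - 1) * k) * rat_of_nat k / (4 * rat_of_nat k ^ 2 - 1)
      * ((rat_of_nat n - 1) gchoose k) ^ a * ((- rat_of_nat n - 1) gchoose k) ^ b) \<in> \<int>"
    unfolding opp opposite_sign_mult_gchoose_powers[OF n a] unfolding times_divide_eq_right by (rule alternating_sum_odd_weight_int[OF n a b])
  show "(\<Sum>k<n. (-1) ^ ((a + b) * k) / rat_of_nat ((k + 2) choose 2)
      * ((rat_of_nat n - 1) gchoose k) ^ a * ((- rat_of_nat n - 1) gchoose k) ^ b) \<in> \<int>"
    unfolding same sign_mult_gchoose_powers[OF n] by (rule sum_triangle_weight_int[OF n a b])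
  show "(\<Sum>k<n. (-1) ^ ((a + b - 1) * k) * (2 * rat_of_nat k + 3) / rat_of_nat ((k + 2) choose 2)
      * ((rat_of_nat n - 1) gchoose k) ^ a * ((- rat_of_nat n - 1) gchoose k) ^ b) \<in> \<int>"
    unfolding opp opposite_sign_mult_gchoose_powers[OF n a] unfolding times_divide_eq_right by (rule alternating_sum_triangle_weight_int[OF n a b])
  show "(\<Sum>k<n. (-1) ^ ((a + b) * k) * (3 * rat_of_nat k + 1) / ((2 * rat_of_nat k + 1) * rat_of_nat ((2 * k) choose k))
      * ((rat_of_nat n - 1) gchoose k) ^ a * ((- rat_of_nat n - 1) gchoose k) ^ b) \<in> \<int>"
    unfolding same(2) sign_mult_gchoose_powers[OF n] by (rule sum_central_binomial_weight_int[OF n a b])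
  show "(\<Sum>k<n. (-1) ^ ((a + b - 1) * k) * (5 * rat_of_nat k + 3) / ((2 * rat_of_nat k + 1) * rat_of_nat ((2 * k) choose k))
      * ((rat_of_nat n - 1) gchoose k) ^ a * ((- rat_of_nat n - 1) gchoose k) ^ b) \<in> \<int>"
    unfolding opp opposite_sign_mult_gchoose_powers[OF n a] unfolding times_divide_eq_right
    by (rule alternating_sum_central_binomial_weight_int[OF n a b])
qed

end
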